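(* Let $F(x,y) = x^3 + a_2 x^2 y + a_1 x y^2 + a_0 y^3 \in \mathbb{Z}[x,y]$ be an irreducible cubic form such that $\operatorname{Gal}(F) \cong A_3$. Put $I(F) = a_2^2 - 3a_1$ and $J(F) = -2a_2^3 + 9 a_2 a_1 - 27 a_0$. Then there exist integers $c_1, c_2, s, t$ with $\gcd(s,t) = 1$ such that one of the following three possibilities holds: (1) $3 \nmid s^2 - st + t^2$ and, with $c = c_1^2 - c_1 c_2 + c_2^2$, \[ I(F) = 9c(s^2 - st + t^2), \] \[ J(F) = 27c\left((2c_1 - c_2)s^3 - 3(c_1 + c_2)s^2 t + 3(2c_2 - c_1)st^2 + (2c_1 - c_2)t^3\right); \] (2) $3 \nmid c_1$, $3 \nmid s^2 - st + t^2$ and, with $c = c_1^2 - 3c_1 c_2 + 9c_2^2$, \[ I(F) = 3c(s^2 - st + t^2), \] \[ J(F) = 27c\left(c_2 s^3 + (c_1 - 3c_2)s^2 t - c_1 st^2 + c_2 t^3\right); \] (3) $3 \nmid c_1$, $3 \nmid s^2 - st + t^2$ and, with $c = c_1^2 - 3c_1 c_2 + 9c_2^2$, \[ I(F) = c(s^2 - st + t^2), \] \[ J(F) = c\left((2c_1 - 3c_2)s^3 - 3(c_1 + 3c_2)s^2 t + 3(6c_2 - c_1)st^2 + (2c_1 - 3c_2)t^3\right). \]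
   Context: $\operatorname{Gal}(F)$ denotes the Galois group over $\mathbb{Q}$ of the splitting field of $F(x,1)$, and $A_3$ is the alternating group on three letters (cyclic of order $3$). Irreducible means irreducible over $\mathbb{Q}$. *)

theory Defs
  imports
    "HOL-Algebra.Algebraic_Closure_Type"
    "HOL-Algebra.Generated_Fields"
    "HOL-Algebra.Sym_Groups"
    "HOL-Algebra.Bij"
    "HOL-Computational_Algebra.Computational_Algebra"
    Complex_Main
begin

(* Z[x,y] is represented as Z[y][x]: the outer indeterminate is x, the inner one is y. *)
definition cubic_form :: "int \<Rightarrow> int \<Rightarrow> int \<Rightarrow> int poly poly" where
  "cubic_form a2 a1 a0 =
     monom 1 3 + monom (monom a2 1) 2 + monom (monom a1 2) 1 + monom (monom a0 3) 0"

definition irreducible_over_rat :: "int poly poly \<Rightarrow> bool" where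
  "irreducible_over_rat F \<longleftrightarrow> Factorial_Ring.irreducible (map_poly (map_poly rat_of_int) F)"

(* F(x,1) *)
definition dehomogenise :: "int poly poly \<Rightarrow> int poly" where
  "dehomogenise F = map_poly (\<lambda>p. poly p 1) F"

definition inv_I :: "int \<Rightarrow> int \<Rightarrow> int \<Rightarrow> int" where
  "inv_I a2 a1 a0 = a2^2 - 3 * a1"

definition inv_J :: "int \<Rightarrow> int \<Rightarrow> int \<Rightarrow> int" where
  "inv_J a2 a1 a0 = - 2 * a2^3 + 9 * a2 * a1 - 27 * a0"

abbreviation complex_field :: "complex ring" where
  "complex_field \<equiv> ring_of_type_algebra"

(* The splitting field over the rationals inside the complex numbers (for p nonzero);
   the rationals need not be adjoined since they are the prime field. *)
definition splitting_field :: "rat poly \<Rightarrow> complex set" where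
  "splitting_field p = generate_field complex_field {z. poly (map_poly of_rat p) z = 0}"

(* The field automorphisms of the subfield K fixing the rationals, under composition;
   the elements of Bij K are the permutations of K extended by undefined outside K. *)
definition galois_group :: "complex set \<Rightarrow> (complex \<Rightarrow> complex) monoid" where
  "galois_group K = (BijGroup K)
     \<lparr> carrier := {\<sigma> \<in> Bij K.
         \<sigma> \<in> ring_iso (complex_field\<lparr>carrier := K\<rparr>) (complex_field\<lparr>carrier := K\<rparr>) \<and>
         (\<forall>q\<in>\<rat>. \<sigma> q = q)} \<rparr>"

definition Gal :: "int poly poly \<Rightarrow> (complex \<Rightarrow> complex) monoid" where
  "Gal F = galois_group (splitting_field (map_poly rat_of_int (dehomogenise F)))"

lemma dehomogenise_cubic_form: "dehomogenise (cubic_form a2 a1 a0) = [:a0, a1, a2, 1:]"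
  by (rule poly_eqI)
     (auto simp: dehomogenise_def cubic_form_def coeff_map_poly poly_monom coeff_pCons
           split: nat.split)

lemma group_galois_group:
  assumes "subfield K complex_field"
  shows "group (galois_group K)"
proof -
  let ?S = "{\<sigma> \<in> Bij K. \<sigma> \<in> ring_iso (complex_field\<lparr>carrier := K\<rparr>) (complex_field\<lparr>carrier := K\<rparr>) \<and>
              (\<forall>q\<in>\<rat>. \<sigma> q = q)}"
  have add: "u + v \<in> K" if "u \<in> K" "v \<in> K" for u v
    using that subringE(7)[OF subfieldE(1)[OF assms], of u v]
    by (simp add: ring_of_type_algebra_def)
  have mult: "u * v \<in> K" if "u \<in> K" "v \<in> K" for u v
    using that subringE(6)[OF subfieldE(1)[OF assms], of u v]
    by (simp add: ring_of_type_algebra_def)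
  have one: "1 \<in> K"
    using subringE(3)[OF subfieldE(1)[OF assms]] by (simp add: ring_of_type_algebra_def)
  have minus: "- u \<in> K" if "u \<in> K" for u
  proof -
    interpret C: cring complex_field by (rule cring_from_type_algebra)
    have "\<ominus>\<^bsub>complex_field\<^esub> u = - u"
      by (rule C.minus_equality) (auto simp: ring_of_type_algebra_def)
    then show ?thesis using subringE(5)[OF subfieldE(1)[OF assms] that] by simp
  qed
  have S: "\<sigma> \<in> ?S \<longleftrightarrow> \<sigma> \<in> Bij K \<and> (\<forall>x\<in>K. \<forall>y\<in>K. \<sigma> (x * y) = \<sigma> x * \<sigma> y) \<and>
      (\<forall>x\<in>K. \<forall>y\<in>K. \<sigma> (x + y) = \<sigma> x + \<sigma> y) \<and> (\<forall>q\<in>\<rat>. \<sigma> q = q)" for \<sigma>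
    by (auto simp: ring_iso_def ring_hom_def ring_of_type_algebra_def Bij_def bij_betw_def)
  have nat: "of_nat n \<in> K" for n
  proof (induction n)
    case 0
    show ?case using add[OF one minus[OF one]] by simp
  qed (use add one in auto)
  have int: "of_int i \<in> K" for i
    by (cases i rule: int_cases2) (use nat minus in auto)
  have inv: "inverse u \<in> K" if "u \<in> K" "u \<noteq> 0" for u
  proof -
    interpret C: cring complex_field by (rule cring_from_type_algebra)
    have "inv\<^bsub>complex_field\<^esub> u = inverse u"
      by (rule C.comm_inv_char) (use that in \<open>auto simp: ring_of_type_algebra_def\<close>)
    moreover have "inv\<^bsub>complex_field\<^esub> u \<in> K"
      using C.subfield_m_inv(1)[OF assms, of u] that by (simp add: ring_of_type_algebra_def)
    ultimately show ?thesis by simp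
  qed
  have rat: "\<rat> \<subseteq> K"
  proof
    fix q :: complex assume "q \<in> \<rat>"
    then obtain a b where "q = of_int a / of_int b" "b \<noteq> 0" by (elim Rats_cases') auto
    then show "q \<in> K" using mult[OF int[of a] inv[OF int[of b]]] by (simp add: divide_inverse)
  qed
  have "subgroup ?S (BijGroup K)"
  proof (rule subgroup.intro)
    show "?S \<subseteq> carrier (BijGroup K)" by (auto simp: BijGroup_def)
  next
    fix x y assume "x \<in> ?S" "y \<in> ?S"
    then show "x \<otimes>\<^bsub>BijGroup K\<^esub> y \<in> ?S"
      unfolding S using add mult rat Bij_imp_funcset[of y K]
      by (auto simp: BijGroup_def compose_Bij[unfolded compose_def] compose_def Pi_iff subset_iff)
  next
    show "\<one>\<^bsub>BijGroup K\<^esub> \<in> ?S"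
      unfolding S using add mult rat by (auto simp: BijGroup_def id_Bij)
  next
    fix x assume x: "x \<in> ?S"
    then have xB: "x \<in> Bij K" by simp
    note xS = x[unfolded S]
    have [simp]: "inv_into K x q = q" if "q \<in> \<rat>" for q
      using that x rat by (metis (mono_tags, lifting) Bij_def Int_iff S bij_betw_inv_into_left mem_Collect_eq subsetD)
    have "inv_into K x (u * v) = inv_into K x u * inv_into K x v" if "u \<in> K" "v \<in> K" for u v
      by (rule Bij_inv_into_lemma) (use xS that mult in auto)
    moreover have "inv_into K x (u + v) = inv_into K x u + inv_into K x v" if "u \<in> K" "v \<in> K" for u v
      by (rule Bij_inv_into_lemma) (use xS that add in auto)
    ultimately show "inv\<^bsub>BijGroup K\<^esub> x \<in> ?S"
      unfolding S inv_BijGroup[OF xB] using add mult rat xB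
      by (auto simp: restrict_inv_into_Bij)
  qed
  then show ?thesis
    unfolding galois_group_def by (rule subgroup.subgroup_is_group[OF _ group_BijGroup])
qed

end

theory Submission
  imports Defs
begin

text \<open>
  The syzygy \<open>4 I\<^sup>3 = J\<^sup>2 + 27 D\<close>, with \<open>D\<close> the discriminant, becomes \<open>\<alpha> \<alpha>' = I\<^sup>3\<close> for the
  Eisenstein integer \<open>\<alpha> = (J + 3 \<delta> \<surd>-3) / 2\<close> as soon as \<open>D = \<delta>\<^sup>2\<close> for an integer \<open>\<delta>\<close>. Unique
  factorisation then gives \<open>\<alpha> = \<gamma>\<^sup>2 \<gamma>' \<sigma>\<^sup>3\<close> and \<open>I = \<gamma> \<gamma>' \<sigma> \<sigma>'\<close> with \<open>\<sigma>\<close> coprime to its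
  conjugate \<open>\<sigma>'\<close>; since \<open>J\<close> is the trace of \<open>\<alpha>\<close>, this is the asserted parametrisation with
  \<open>\<sigma> = s + t \<omega>\<close>, and the three cases are those in which \<open>\<surd>-3\<close> divides \<open>\<gamma>\<close> at least twice, once,
  or not at all.

  That \<open>\<delta> = (r\<^sub>1 - r\<^sub>2) (r\<^sub>2 - r\<^sub>3) (r\<^sub>3 - r\<^sub>1)\<close> is rational needs no Galois correspondence. An
  automorphism of order dividing 3 permutes the roots cyclically, so it fixes \<open>\<delta>\<close>, and some
  automorphism moves every root. If \<open>\<delta>\<close> lies in \<open>L = \<rat>(r\<^sub>1)\<close>, then \<open>\<delta> = q(r\<^sub>i)\<close> for all three roots
  and a rational polynomial \<open>q\<close> of degree at most 2, so \<open>q\<close> is constant. Otherwise the splitting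
  field is \<open>L + L \<delta>\<close>, and its conjugation over \<open>L\<close> is an automorphism that negates \<open>\<delta>\<close>.
\<close>

subsection \<open>Eisenstein integers\<close>

definition eis_omega :: complex where
  "eis_omega = Complex (-1/2) (sqrt 3 / 2)"

lemma eis_omega_square: "eis_omega * eis_omega = - 1 - eis_omega"
  by (simp add: eis_omega_def complex_eq_iff)

lemma cnj_eis_omega: "cnj eis_omega = - 1 - eis_omega"
  by (simp add: eis_omega_def complex_eq_iff)

definition eis :: "int \<Rightarrow> int \<Rightarrow> complex" where
  "eis a b = of_int a + of_int b * eis_omega"

text \<open>Input only, so that goals keep the expanded form, which is literally the one in the
  theorem.\<close>

abbreviation (input) eis_norm :: "int \<Rightarrow> int \<Rightarrow> int" where
  "eis_norm a b \<equiv> a^2 - a*b + b^2"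

lemma eis_eq_iff: "eis a b = eis c d \<longleftrightarrow> a = c \<and> b = d"
  by (auto simp: eis_def eis_omega_def complex_eq_iff)

lemma eis_of_int: "of_int n = eis n 0"
  by (simp add: eis_def)

lemma eis_one: "1 = eis 1 0"
  by (simp add: eis_def)

lemma eis_add: "eis a b + eis c d = eis (a + c) (b + d)"
  by (simp add: eis_def algebra_simps)

lemma eis_diff: "eis a b - eis c d = eis (a - c) (b - d)"
  by (simp add: eis_def algebra_simps)

lemma eis_mult: "eis a b * eis c d = eis (a*c - b*d) (a*d + b*c - b*d)"
proof -
  have "eis a b * eis c d = of_int (a*c) + of_int (a*d + b*c) * eis_omega
          + of_int (b*d) * (eis_omega * eis_omega)"
    by (simp add: eis_def algebra_simps)
  then show ?thesis
    by (simp add: eis_omega_square) (simp add: eis_def algebra_simps)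
qed

lemma eis_cnj: "cnj (eis a b) = eis (a - b) (- b)"
  by (simp add: eis_def cnj_eis_omega algebra_simps)

lemma eis_mult_cnj: "eis a b * cnj (eis a b) = of_int (eis_norm a b)"
  by (simp add: eis_cnj eis_mult eis_of_int eis_eq_iff power2_eq_square algebra_simps)

lemma eis_norm_nonneg: "eis_norm a b \<ge> 0"
proof -
  have "4 * eis_norm a b = (2*a - b)^2 + 3 * b^2"
    by (simp add: power2_eq_square algebra_simps)
  then show ?thesis
    by (smt (verit) zero_le_power2)
qed

text \<open>Reduction modulo the prime \<surd>-3 above 3 sends \<omega> to 1, hence a + b \<omega>
  to a + b modulo 3.\<close>

lemma three_dvd_eis_norm_iff: "3 dvd eis_norm a b \<longleftrightarrow> 3 dvd a + b"
proof -
  have "eis_norm a b = (a + b)^2 - 3 * (a * b)"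
    by (simp add: power2_eq_square algebra_simps)
  then have "3 dvd eis_norm a b \<longleftrightarrow> 3 dvd (a + b)^2"
    using dvd_diff_left_iff[of 3 "3 * (a * b)" "(a + b)^2"] by (metis dvd_triv_left)
  then show ?thesis by (simp add: prime_dvd_power_iff)
qed

lemma cmod_eis_square: "(cmod (eis a b))^2 = of_int (eis_norm a b)"
proof -
  have "complex_of_real ((cmod (eis a b))^2) = complex_of_real (of_int (eis_norm a b))"
    using complex_norm_square[of "eis a b"] eis_mult_cnj[of a b] by simp
  then show ?thesis by (simp only: of_real_eq_iff)
qed

text \<open>The ring is kept as a set of complex numbers, so that field arithmetic,
  \<open>cnj\<close> and \<open>cmod\<close> apply directly.\<close>

definition eisenstein :: "complex set" where
  "eisenstein = {z. \<exists>a b. z = eis a b}"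

lemma eisensteinE:
  assumes "z \<in> eisenstein"
  obtains a b where "z = eis a b"
  using assms by (auto simp: eisenstein_def)

lemma eisenstein_closed:
  "eis a b \<in> eisenstein" "of_int n \<in> eisenstein" "1 \<in> eisenstein" "0 \<in> eisenstein"
  "z \<in> eisenstein \<Longrightarrow> w \<in> eisenstein \<Longrightarrow> z + w \<in> eisenstein"
  "z \<in> eisenstein \<Longrightarrow> w \<in> eisenstein \<Longrightarrow> z - w \<in> eisenstein"
  "z \<in> eisenstein \<Longrightarrow> w \<in> eisenstein \<Longrightarrow> z * w \<in> eisenstein"
  "z \<in> eisenstein \<Longrightarrow> cnj z \<in> eisenstein"
proof -
  show "1 \<in> eisenstein" "0 \<in> eisenstein"
    using eis_of_int[of 1] eis_of_int[of 0] by (auto simp: eisenstein_def)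
qed (unfold eisenstein_def, auto simp: eis_add eis_diff eis_mult eis_cnj eis_of_int, blast+)

text \<open>Rounding both coordinates of z in the basis 1, \<omega> leaves an error u + v \<omega>
  with u and v at most 1/2 in absolute value. Its squared modulus u^2 - u v + v^2 is at most 3/4,
  which makes the ring Euclidean.\<close>

lemma eisenstein_rounding: "\<exists>q\<in>eisenstein. cmod (z - q) < 1"
proof -
  define y where "y = Im z * 2 / sqrt 3"
  define x where "x = Re z + y / 2"
  define u where "u = x - of_int (round x)"
  define v where "v = y - of_int (round y)"
  have "Re z = x - y / 2" "Im z = y * sqrt 3 / 2"
    by (simp_all add: x_def y_def)
  then have z: "z - eis (round x) (round y) = Complex (u - v / 2) (v * sqrt 3 / 2)"
    by (simp add: eis_def eis_omega_def complex_eq_iff u_def v_def algebra_simps diff_divide_distrib)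
  have u: "\<bar>u\<bar> \<le> 1/2" and v: "\<bar>v\<bar> \<le> 1/2"
    using of_int_round_abs_le[of x] of_int_round_abs_le[of y] by (auto simp: u_def v_def abs_minus_commute)
  have "u^2 \<le> (1/2)^2" "v^2 \<le> (1/2)^2"
    using u v by (metis abs_le_square_iff abs_of_nonneg half_gt_zero_iff less_eq_real_def zero_less_one)+
  moreover have "\<bar>u * v\<bar> \<le> 1/2 * (1/2)"
    unfolding abs_mult by (rule mult_mono) (use u v in auto)
  moreover have "(cmod (Complex (u - v / 2) (v * sqrt 3 / 2)))^2 = u^2 - u*v + v^2"
    unfolding cmod_power2 by (simp add: power2_eq_square field_simps)
  ultimately have "(cmod (z - eis (round x) (round y)))^2 < 1"
    unfolding z by (simp add: power2_eq_square abs_if split: if_splits)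
  then have "cmod (z - eis (round x) (round y)) < 1"
    by (simp add: power_less_one_iff abs_square_less_1)
  then show ?thesis using eisenstein_closed(1) by blast
qed

text \<open>A nonzero element d of least norm in the ideal generated by \<alpha> and \<beta> divides
  the whole ideal: a nonzero remainder after division by d would lie in the ideal and have smaller
  norm.\<close>

lemma eisenstein_bezout:
  assumes "\<alpha> \<in> eisenstein" "\<beta> \<in> eisenstein" "\<beta> \<noteq> 0"
  obtains d x y p q where "d \<noteq> 0" "d \<in> eisenstein" "x \<in> eisenstein" "y \<in> eisenstein"
    "p \<in> eisenstein" "q \<in> eisenstein" "d = x * \<alpha> + y * \<beta>" "\<alpha> = d * p" "\<beta> = d * q"
proof -
  define S where "S = {z. z \<noteq> 0 \<and> (\<exists>x\<in>eisenstein. \<exists>y\<in>eisenstein. z = x * \<alpha> + y * \<beta>)}"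
  \<comment> \<open>The floor only serves to land in \<open>nat\<close>, where minima exist; on
    Eisenstein integers \<open>N\<close> is exactly the norm.\<close>
  define N where "N z = nat \<lfloor>(cmod z)^2\<rfloor>" for z
  have SE: "z \<in> eisenstein" if "z \<in> S" for z
    using that assms by (auto simp: S_def intro!: eisenstein_closed)
  have N: "real (N z) = (cmod z)^2" if zE: "z \<in> eisenstein" for z
  proof -
    obtain a b where z: "z = eis a b" using zE by (rule eisensteinE)
    show ?thesis
      unfolding N_def z cmod_eis_square floor_of_int
      using eis_norm_nonneg[of a b] by (simp only: of_nat_nat)
  qed
  have "\<beta> = 0 * \<alpha> + 1 * \<beta>" by simp
  then have "\<beta> \<in> S" using assms(3) eisenstein_closed(3,4) unfolding S_def by blast
  then obtain d where d: "d \<in> S" and least: "\<And>z. z \<in> S \<Longrightarrow> N d \<le> N z"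
    using ex_has_least_nat[of "\<lambda>z. z \<in> S" \<beta> N] by blast
  obtain x y where xy: "x \<in> eisenstein" "y \<in> eisenstein" "d = x * \<alpha> + y * \<beta>" and d0: "d \<noteq> 0"
    using d by (auto simp: S_def)
  have dvd: "\<exists>q\<in>eisenstein. z = d * q"
    if z: "x' \<in> eisenstein" "y' \<in> eisenstein" "z = x' * \<alpha> + y' * \<beta>" for z x' y'
  proof -
    obtain q where q: "q \<in> eisenstein" "cmod (z / d - q) < 1"
      using eisenstein_rounding by blast
    have "cmod (z - d * q) = cmod d * cmod (z / d - q)"
      using d0 by (simp add: norm_mult[symmetric] right_diff_distrib)
    also have "\<dots> < cmod d * 1"
      by (rule mult_strict_left_mono) (use q d0 in auto)
    finally have less: "cmod (z - d * q) < cmod d" by simp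
    have r: "z - d * q = (x' - x * q) * \<alpha> + (y' - y * q) * \<beta>"
      by (simp add: z xy(3) algebra_simps)
    have "z - d * q = 0"
    proof (rule ccontr)
      assume "z - d * q \<noteq> 0"
      then have "z - d * q \<in> S"
        unfolding S_def using r z(1,2) xy(1,2) q(1) eisenstein_closed(6,7) by blast
      with least SE d have "(cmod d)^2 \<le> (cmod (z - d * q))^2"
        using N by (metis of_nat_le_iff)
      with less show False
        by (meson norm_ge_zero not_less power2_less_imp_less power_strict_mono zero_less_numeral)
    qed
    with q show ?thesis by (intro bexI[of _ q]) auto
  qed
  obtain p where p: "p \<in> eisenstein" "\<alpha> = d * p"
    using dvd[of 1 0 \<alpha>] eisenstein_closed(3,4) by auto
  obtain q where q: "q \<in> eisenstein" "\<beta> = d * q"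
    using dvd[of 0 1 \<beta>] eisenstein_closed(3,4) by auto
  show ?thesis
    by (rule that[OF d0 SE[OF d] xy(1,2) p(1) q(1) xy(3) p(2) q(2)])
qed

text \<open>An integer dividing s and t divides both s + t \<omega> and its conjugate. So does the
  prime above 3 once it divides the norm, being associate to its own conjugate. The Bezout relation
  excludes both.\<close>

lemma eisenstein_coprime_imp:
  assumes "x \<in> eisenstein" "y \<in> eisenstein" "x * eis s t + y * cnj (eis s t) = 1"
  shows "gcd s t = 1" "\<not> 3 dvd eis_norm s t"
proof -
  obtain x1 x2 y1 y2 where x: "x = eis x1 x2" and y: "y = eis y1 y2"
    using assms by (auto simp: eisenstein_def)
  define g where "g = gcd s t"
  have 1: "x1*s - x2*t + (y1*(s - t) - y2*(-t)) = 1"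
    using assms(3) unfolding x y eis_cnj eis_mult eis_add eis_one eis_eq_iff by simp
  have "g dvd x1*s - x2*t + (y1*(s - t) - y2*(-t))"
    unfolding g_def by (intro dvd_add dvd_diff dvd_mult) auto
  with 1 have "g dvd 1" by simp
  then show "gcd s t = 1" by (simp add: g_def)
  show "\<not> 3 dvd eis_norm s t"
  proof
    assume "3 dvd eis_norm s t"
    then have "3 dvd s + t" by (simp only: three_dvd_eis_norm_iff)
    then obtain k where "t = 3 * k - s" by (metis add_diff_cancel_left' dvdE)
    \<comment> \<open>\<open>eis 1 (-1)\<close> is 1 - \<omega>, a prime above 3.\<close>
    then have "eis s t = eis 1 (-1) * eis (s - k) k" "cnj (eis s t) = eis 1 (-1) * eis (s - k) (s - 2*k)"
      by (simp_all add: eis_cnj eis_mult eis_eq_iff)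
    then have "eis 1 (-1) * (x * eis (s - k) k + y * eis (s - k) (s - 2*k)) = 1"
      using assms(3) by (simp add: algebra_simps)
    \<comment> \<open>The two coordinates of a multiple of 1 - \<omega> have a sum divisible by 3,
      but those of 1 have sum 1.\<close>
    then show False
      unfolding x y eis_mult eis_add eis_one eis_eq_iff by presburger
  qed
qed

section \<open>Eisenstein integers whose norm is a cube\<close>

text \<open>With \<open>\<beta> = gcd(\<alpha>, I)\<close>, \<open>\<alpha> = \<beta>\<kappa>\<close>, \<open>I = \<beta>\<tau>\<close>, reality of \<open>I\<close> gives
  \<open>\<kappa> \<kappa>' = \<beta> \<tau>\<^sup>2 \<tau>'\<close> (primes denote conjugates), so \<open>\<tau>\<^sup>2\<close> divides \<open>\<kappa>'\<close>.\<close>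
lemma eisenstein_norm_cube:
  assumes \<alpha>: "\<alpha> \<in> eisenstein" and norm: "\<alpha> * cnj \<alpha> = of_int I ^ 3" and "I \<noteq> 0"
  obtains \<gamma> \<sigma> x y where "\<gamma> \<in> eisenstein" "\<sigma> \<in> eisenstein" "x \<in> eisenstein" "y \<in> eisenstein"
    "x * \<sigma> + y * cnj \<sigma> = 1" "\<alpha> = \<gamma> * cnj \<gamma> * \<gamma> * \<sigma> ^ 3" "of_int I = \<gamma> * cnj \<gamma> * (\<sigma> * cnj \<sigma>)"
proof -
  obtain \<beta> x y \<kappa> \<tau> where \<beta>: "\<beta> \<noteq> 0" "\<beta> \<in> eisenstein" and xy: "x \<in> eisenstein" "y \<in> eisenstein"
    and \<kappa>: "\<kappa> \<in> eisenstein" "\<alpha> = \<beta> * \<kappa>" and \<tau>: "\<tau> \<in> eisenstein" "of_int I = \<beta> * \<tau>"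
    and bez: "\<beta> = x * \<alpha> + y * of_int I"
    using eisenstein_bezout[OF \<alpha>, of "of_int I"] \<open>I \<noteq> 0\<close> eisenstein_closed(2)
    by (metis of_int_eq_0_iff)
  have \<tau>0: "\<tau> \<noteq> 0" using \<tau>(2) \<open>I \<noteq> 0\<close> by auto
  have "\<beta> * (x * \<kappa> + y * \<tau>) = \<beta> * 1"
    using bez \<kappa>(2) \<tau>(2) by (simp add: algebra_simps)
  then have bez1: "x * \<kappa> + y * \<tau> = 1" using \<beta>(1) by simp
  have real: "\<beta> * \<tau> = cnj \<beta> * cnj \<tau>"
    using \<tau>(2) by (metis complex_cnj_mult complex_cnj_of_int)
  have n: "\<beta> * \<kappa> * (cnj \<beta> * cnj \<kappa>) = (\<beta> * \<tau>) ^ 3"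
    using norm \<kappa>(2) \<tau>(2) by simp
  have "(\<beta> * cnj \<beta> * cnj \<tau>) * (\<kappa> * cnj \<kappa>) = (\<beta> * \<kappa> * (cnj \<beta> * cnj \<kappa>)) * cnj \<tau>"
    by (simp add: algebra_simps)
  also have "\<dots> = (\<beta> * \<tau>) * (\<beta> * \<tau>) * (\<beta> * \<tau>) * cnj \<tau>"
    unfolding n by (simp add: power3_eq_cube)
  also have "\<dots> = (\<beta> * cnj \<beta> * cnj \<tau>) * (\<beta> * \<tau>^2 * cnj \<tau>)"
    by (subst real) (simp add: power2_eq_square)
  finally have k: "\<kappa> * cnj \<kappa> = \<beta> * \<tau>^2 * cnj \<tau>"
    using \<beta>(1) \<tau>0 by (simp only: mult_cancel_left) auto
  \<comment> \<open>The quotient of \<open>cnj \<kappa>\<close> by \<open>\<tau>^2\<close>: in the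
    expansion of \<open>cnj \<kappa> * (x * \<kappa> + y * \<tau>) ^ 2\<close>, replacing
    \<open>\<kappa> * cnj \<kappa>\<close> by \<open>\<beta> * \<tau>^2 * cnj \<tau>\<close> puts
    the factor \<open>\<tau>^2\<close> into every term.\<close>
  define g where "g = x^2 * \<kappa> * \<beta> * cnj \<tau> + 2 * x * y * \<tau> * \<beta> * cnj \<tau> + y^2 * cnj \<kappa>"
  have g: "g \<in> eisenstein"
  proof -
    have "2 \<in> eisenstein" using eisenstein_closed(2)[of 2] by simp
    then show ?thesis
      unfolding g_def power2_eq_square
      by (intro eisenstein_closed(5,7,8)) (use \<beta> xy \<kappa> \<tau> in auto)
  qed
  have "cnj \<kappa> = cnj \<kappa> * (x * \<kappa> + y * \<tau>) ^ 2" by (simp add: bez1)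
  also have "\<dots> = x^2 * \<kappa> * (\<kappa> * cnj \<kappa>) + 2 * x * y * \<tau> * (\<kappa> * cnj \<kappa>) + y^2 * \<tau>^2 * cnj \<kappa>"
    by (simp add: power2_eq_square algebra_simps)
  also have "\<dots> = \<tau>^2 * g"
    unfolding k g_def by (simp add: algebra_simps)
  finally have ck: "cnj \<kappa> = \<tau>^2 * g" .
  then have k': "\<kappa> = (cnj \<tau>)^2 * cnj g"
    by (metis complex_cnj_cnj complex_cnj_mult complex_cnj_power)
  \<comment> \<open>Substituting \<open>ck\<close> and its conjugate \<open>k'\<close> into
    \<open>k\<close> and cancelling expresses \<beta> through \<tau> and g.\<close>
  have "(\<tau>^2 * cnj \<tau>) * \<beta> = \<kappa> * cnj \<kappa>" by (simp add: k)
  also have "\<dots> = (\<tau>^2 * cnj \<tau>) * (cnj \<tau> * cnj g * g)"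
    by (subst ck, subst k') (simp add: power2_eq_square)
  finally have "(\<tau>^2 * cnj \<tau>) * \<beta> = (\<tau>^2 * cnj \<tau>) * (cnj \<tau> * cnj g * g)" .
  moreover have "\<tau>^2 * cnj \<tau> \<noteq> 0" using \<tau>0 by simp
  ultimately have b: "\<beta> = cnj \<tau> * cnj g * g"
    using mult_left_cancel by blast
  \<comment> \<open>The witnesses are \<gamma> = \<open>cnj g\<close> and \<sigma> =
    \<open>cnj \<tau>\<close>. As \<kappa> is a multiple of \<sigma>, the relation
    \<open>bez1\<close> between \<kappa> and \<tau> becomes one between \<sigma> and its
    conjugate.\<close>
  show ?thesis
  proof (rule that)
    show "(x * cnj \<tau> * cnj g) * cnj \<tau> + y * cnj (cnj \<tau>) = 1"
      using bez1 unfolding k' by (simp add: power2_eq_square algebra_simps)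
    show "\<alpha> = cnj g * cnj (cnj g) * cnj g * cnj \<tau> ^ 3"
      unfolding \<kappa>(2) b k' by (simp add: power2_eq_square power3_eq_cube algebra_simps)
    show "of_int I = cnj g * cnj (cnj g) * (cnj \<tau> * cnj (cnj \<tau>))"
      unfolding \<tau>(2) b by (simp add: algebra_simps)
  qed (use g xy \<tau> eisenstein_closed(7,8) in auto)
qed

text \<open>The coordinates of \<open>a + b \<omega> = \<gamma>\<^sup>2 \<gamma>' \<sigma>\<^sup>3\<close> for \<open>\<gamma> = c + d \<omega>\<close> and \<open>\<sigma> = s + t \<omega>\<close>.\<close>
lemma norm_form_cube:
  fixes a b I :: int
  assumes "eis_norm a b = I ^ 3" "I \<noteq> 0"
  obtains c d s t where "gcd s t = 1" "\<not> 3 dvd eis_norm s t" "I = eis_norm c d * eis_norm s t"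
    "a = eis_norm c d * (c * (s^3 + t^3 - 3*s*t^2) - d * (3*s^2*t - 3*s*t^2))"
    "b = eis_norm c d * (c * (3*s^2*t - 3*s*t^2) + d * (s^3 + t^3 - 3*s^2*t))"
proof -
  have "eis a b * cnj (eis a b) = of_int I ^ 3"
    by (simp only: eis_mult_cnj assms(1) of_int_power)
  then obtain \<gamma> \<sigma> x y where *: "\<gamma> \<in> eisenstein" "\<sigma> \<in> eisenstein" "x \<in> eisenstein" "y \<in> eisenstein"
    "x * \<sigma> + y * cnj \<sigma> = 1" "eis a b = \<gamma> * cnj \<gamma> * \<gamma> * \<sigma> ^ 3" "of_int I = \<gamma> * cnj \<gamma> * (\<sigma> * cnj \<sigma>)"
    using eisenstein_norm_cube[OF eisenstein_closed(1) _ assms(2)] by metis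
  obtain c d s t where [simp]: "\<gamma> = eis c d" "\<sigma> = eis s t"
    using * by (auto simp: eisenstein_def)
  have 1: "gcd s t = 1" "\<not> 3 dvd eis_norm s t"
    using eisenstein_coprime_imp[of x y s t] * by auto
  have "complex_of_int I = of_int (eis_norm c d * eis_norm s t)"
    using *(7) by (simp only: \<open>\<gamma> = eis c d\<close> \<open>\<sigma> = eis s t\<close> eis_mult_cnj of_int_mult)
  then have 2: "I = eis_norm c d * eis_norm s t"
    by (simp only: of_int_eq_iff)
  have "eis a b = eis (eis_norm c d) 0 * eis c d * (eis s t * eis s t * eis s t)"
    using *(6) by (simp only: \<open>\<gamma> = eis c d\<close> \<open>\<sigma> = eis s t\<close> eis_mult_cnj eis_of_int power3_eq_cube)
  then have ab: "a = eis_norm c d * (c * (s^3 + t^3 - 3*s*t^2) - d * (3*s^2*t - 3*s*t^2))"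
    "b = eis_norm c d * (c * (3*s^2*t - 3*s*t^2) + d * (s^3 + t^3 - 3*s^2*t))"
    unfolding eis_mult eis_eq_iff
    by (simp_all add: power2_eq_square power3_eq_cube algebra_simps)
  show ?thesis by (rule that[OF 1 2 ab])
qed

text \<open>Division of \<open>c + d \<omega>\<close> by \<open>\<surd>-3 = 1 + 2 \<omega>\<close>.\<close>
lemma eis_norm_sqrt_minus_3:
  assumes "3 dvd eis_norm c d"
  obtains x y where "c = x - 2*y" "d = 2*x - y" "eis_norm c d = 3 * eis_norm x y"
proof -
  have "3 dvd c + d" using assms by (simp only: three_dvd_eis_norm_iff)
  then obtain k where d: "d = 3 * k - c" by (metis add_diff_cancel_left' dvdE)
  then show ?thesis
    by (intro that[of "2*k - c" "k - c"]) (simp_all add: d power2_eq_square algebra_simps)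
qed

text \<open>The syzygy makes I^3 the norm of an Eisenstein integer with trace J, to which
  \<open>norm_form_cube\<close> applies. The condition on J supplies the divisibility of a
  coefficient by 3 that the second family needs.\<close>

lemma syzygy_solutions:
  fixes I J \<delta> :: int
  assumes syz: "4 * I^3 = J^2 + 27 * \<delta>^2" and J: "3 dvd I \<longrightarrow> 27 dvd J"
  shows "\<exists>c1 c2 s t :: int. gcd s t = 1 \<and>
    ((\<not> 3 dvd s^2 - s*t + t^2 \<and>
      (let c = c1^2 - c1*c2 + c2^2 in
        I = 9*c*(s^2 - s*t + t^2) \<and>
        J =
          27*c*((2*c1 - c2)*s^3 - 3*(c1 + c2)*s^2*t + 3*(2*c2 - c1)*s*t^2 + (2*c1 - c2)*t^3)))
    \<or> (\<not> 3 dvd c1 \<and> \<not> 3 dvd s^2 - s*t + t^2 \<and>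
      (let c = c1^2 - 3*c1*c2 + 9*c2^2 in
        I = 3*c*(s^2 - s*t + t^2) \<and>
        J = 27*c*(c2*s^3 + (c1 - 3*c2)*s^2*t - c1*s*t^2 + c2*t^3)))
    \<or> (\<not> 3 dvd c1 \<and> \<not> 3 dvd s^2 - s*t + t^2 \<and>
      (let c = c1^2 - 3*c1*c2 + 9*c2^2 in
        I = c*(s^2 - s*t + t^2) \<and>
        J =
          c*((2*c1 - 3*c2)*s^3 - 3*(c1 + 3*c2)*s^2*t + 3*(6*c2 - c1)*s*t^2 + (2*c1 - 3*c2)*t^3))))"
    (is "\<exists>c1 c2 s t. gcd s t = 1 \<and> (?P1 c1 c2 s t \<or> ?P2 c1 c2 s t \<or> ?P3 c1 c2 s t)")
proof (cases "I = 0")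
  case True
  have "J^2 \<ge> 0" "\<delta>^2 \<ge> 0" by simp_all
  moreover have "J^2 + 27 * \<delta>^2 = 0" using syz True by simp
  ultimately have "J^2 = 0" by linarith
  then have "J = 0" by simp
  \<comment> \<open>The first family with zero coefficients and \<sigma> = 1 yields I = J =
    0.\<close>
  with True have "gcd 1 (0::int) = 1 \<and> (?P1 0 0 1 0 \<or> ?P2 0 0 1 0 \<or> ?P3 0 0 1 0)" by simp
  then show ?thesis by (intro exI)
next
  case False
  have "even (J^2 + 27 * \<delta>^2)" using syz by (metis dvd_mult2 even_numeral)
  then have "even (J + 3 * \<delta>)" by simp
  \<comment> \<open>The element with trace J is m + 3 \<delta> \<omega>; equal parity of J and
    \<delta> makes m an integer.\<close>
  then obtain m where m: "J = 2*m - 3*\<delta>" by (elim evenE) (simp add: algebra_simps)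
  have "eis_norm m (3*\<delta>) = I^3"
    using syz by (simp add: m power2_eq_square algebra_simps)
  from norm_form_cube[OF this False] obtain c d s t where st: "gcd s t = 1" "\<not> 3 dvd eis_norm s t"
    and I: "I = eis_norm c d * eis_norm s t"
    and mm: "m = eis_norm c d * (c * (s^3 + t^3 - 3*s*t^2) - d * (3*s^2*t - 3*s*t^2))"
    and \<delta>: "3 * \<delta> = eis_norm c d * (c * (3*s^2*t - 3*s*t^2) + d * (s^3 + t^3 - 3*s^2*t))"
    by metis
  have "J = 2 * m - 3 * \<delta>" by (fact m)
  also have "\<dots> = eis_norm c d * ((2*c - d)*s^3 - 3*(c + d)*s^2*t + 3*(2*d - c)*s*t^2 + (2*c - d)*t^3)"
    unfolding mm \<delta> by (simp add: algebra_simps)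
  finally have J_eq: "J = \<dots>" .
  have st3: "\<not> 3 dvd s^3 + t^3"
  proof -
    have "s^3 + t^3 = (s + t) * eis_norm s t"
      by (simp add: power2_eq_square power3_eq_cube algebra_simps)
    then show ?thesis
      using st(2) prime_dvd_mult_iff[of "3::int"] three_dvd_eis_norm_iff[of s t] by simp
  qed
  have p3: "prime (3::int)" by simp
  \<comment> \<open>The cases are that \<surd>-3 divides \<gamma> = c + d \<omega> not at all,
    exactly once, or at least twice; dividing by it twice is dividing by -3.\<close>
  consider (unit) "\<not> 3 dvd eis_norm c d"
    | (ramified) x y where "c = x - 2*y" "d = 2*x - y" "eis_norm c d = 3 * eis_norm x y" "\<not> 3 dvd eis_norm x y"
    | (three) u v where "c = - 3 * u" "d = - 3 * v" "eis_norm c d = 9 * eis_norm u v"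
  proof (cases "3 dvd eis_norm c d")
    case True
    then obtain x y where xy: "c = x - 2*y" "d = 2*x - y" "eis_norm c d = 3 * eis_norm x y"
      by (rule eis_norm_sqrt_minus_3)
    show thesis
    proof (cases "3 dvd eis_norm x y")
      case True
      then obtain u v where uv: "x = u - 2*v" "y = 2*u - v" "eis_norm x y = 3 * eis_norm u v"
        by (rule eis_norm_sqrt_minus_3)
      show thesis
        by (rule three[of u v]) (use xy uv in auto)
    qed (use ramified xy in blast)
  qed (use unit in blast)
  then show ?thesis
  proof cases
    case unit
    \<comment> \<open>The \<omega>-coordinate is 3 \<delta>. Modulo 3 it is the norm of \<gamma>
      times d (s^3 + t^3), which forces 3 to divide d.\<close>
    have "3 dvd eis_norm c d * (c * (3*s^2*t - 3*s*t^2) + d * (s^3 + t^3 - 3*s^2*t))"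
      using \<delta> by (metis dvd_triv_left)
    then have "3 dvd c * (3*s^2*t - 3*s*t^2) + d * (s^3 + t^3 - 3*s^2*t)"
      using unit prime_dvd_mult_iff[OF p3] by blast
    moreover have "c * (3*s^2*t - 3*s*t^2) + d * (s^3 + t^3 - 3*s^2*t)
        = d * (s^3 + t^3) + 3 * (c * (s^2*t - s*t^2) - d * s^2 * t)"
      by (simp add: algebra_simps)
    ultimately have "3 dvd d * (s^3 + t^3)"
      by (metis dvd_add_left_iff dvd_triv_left)
    then have "3 dvd d"
      using st3 prime_dvd_mult_iff[OF p3] by blast
    then obtain e where d: "d = 3 * e" by (elim dvdE)
    have "\<not> 3 dvd c" using unit d three_dvd_eis_norm_iff[of c d] by (simp add: dvd_add_left_iff)
    moreover have "eis_norm c d = c^2 - 3*c*e + 9*e^2"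
      by (simp add: d power2_eq_square)
    ultimately have "?P3 c e s t"
      using st I J_eq by (simp add: d Let_def)
    with st(1) have "gcd s t = 1 \<and> (?P1 c e s t \<or> ?P2 c e s t \<or> ?P3 c e s t)" by (simp only: simp_thms)
    then show ?thesis by (intro exI)
  next
    case ramified
    define n where "n = eis_norm x y"
    have n3: "\<not> 3 dvd n" using ramified(4) unfolding n_def .
    have J3: "J = - (9 * (n * (3 * (x * (s^2*t - s*t^2) - y * s^2 * t) + y * (s^3 + t^3))))"
      unfolding J_eq ramified(3) n_def[symmetric] unfolding ramified(1,2) by (simp add: algebra_simps)
    \<comment> \<open>Here I is a multiple of 3, so the condition on J applies; by
      \<open>J3\<close>, J is only visibly a multiple of 9, and the extra factor 3 must come from
      y.\<close>
    have "3 dvd I" using I ramified(3) by simp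
    with J have "27 dvd J" by simp
    then have "9 * 3 dvd 9 * (n * (3 * (x * (s^2*t - s*t^2) - y * s^2 * t) + y * (s^3 + t^3)))"
      using J3 by (simp only: dvd_minus_iff) simp
    then have "3 dvd n * (3 * (x * (s^2*t - s*t^2) - y * s^2 * t) + y * (s^3 + t^3))"
      by (subst (asm) dvd_mult_cancel_left) simp
    then have "3 dvd y * (s^3 + t^3)"
      using n3 prime_dvd_mult_iff[OF p3] by (metis dvd_add_right_iff dvd_triv_left)
    then have "3 dvd y"
      using st3 prime_dvd_mult_iff[OF p3] by blast
    then obtain e where y: "y = 3 * e" by (elim dvdE)
    have "\<not> 3 dvd - x" using n3 y three_dvd_eis_norm_iff[of x y] by (simp add: n_def dvd_add_left_iff)
    moreover have n: "n = (- x)^2 - 3*(- x)*(- e) + 9*(- e)^2"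
      by (simp add: n_def y power2_eq_square)
    moreover have "J = 27 * n * (- e*s^3 + (- x - 3 * (- e))*s^2*t - (- x)*s*t^2 + (- e)*t^3)"
      unfolding J3 y by (simp add: algebra_simps)
    moreover have "I = 3 * n * eis_norm s t"
      using I ramified(3) by (simp only: n_def)
    \<comment> \<open>Negating both coefficients absorbs the minus sign in \<open>J3\<close> and
      leaves the norm n unchanged.\<close>
    ultimately have "?P2 (- x) (- e) s t"
      using st unfolding Let_def by metis
    with st(1) have "gcd s t = 1 \<and> (?P1 (- x) (- e) s t \<or> ?P2 (- x) (- e) s t \<or> ?P3 (- x) (- e) s t)" by (simp only: simp_thms)
    then show ?thesis by (intro exI)
  next
    case (three u v)
    define n where "n = eis_norm u v"
    have "n = eis_norm (- u) (- v)" by (simp add: n_def)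
    moreover have "I = 9 * n * eis_norm s t"
      using I three(3) by (simp only: n_def)
    moreover have "J = 27 * n * ((2 * (- u) - (- v))*s^3 - 3*(- u + - v)*s^2*t + 3*(2*(- v) - (- u))*s*t^2 + (2*(- u) - (- v))*t^3)"
      unfolding J_eq three(3) n_def[symmetric] unfolding three(1,2) by (simp add: algebra_simps)
    \<comment> \<open>The coefficients are the coordinates of \<gamma> / 3, since \<gamma> = -3 (u +
      v \<omega>).\<close>
    ultimately have "?P1 (- u) (- v) s t"
      using st unfolding Let_def by metis
    with st(1) have "gcd s t = 1 \<and> (?P1 (- u) (- v) s t \<or> ?P2 (- u) (- v) s t \<or> ?P3 (- u) (- v) s t)" by (simp only: simp_thms)
    then show ?thesis by (intro exI)
  qed
qed

subsection \<open>Subfields of the complex numbers and their automorphisms\<close>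

text \<open>Trades the record operations of \<open>complex_field\<close> for the type class ones
  used in all later calculations.\<close>

lemma subfield_complex_iff:
  "subfield L complex_field \<longleftrightarrow> 1 \<in> L \<and> (\<forall>x\<in>L. \<forall>y\<in>L. x + y \<in> L) \<and>
     (\<forall>x\<in>L. \<forall>y\<in>L. x * y \<in> L) \<and> (\<forall>x\<in>L. - x \<in> L) \<and> (\<forall>x\<in>L. inverse x \<in> L)"
proof -
  interpret C: field complex_field by (rule field_from_type_algebra)
  have uminus: "\<ominus>\<^bsub>complex_field\<^esub> x = - x" for x
    by (rule C.minus_equality) (auto simp: ring_of_type_algebra_def)
  have inverse: "inv\<^bsub>complex_field\<^esub> x = inverse x" if "x \<noteq> 0" for x
    by (rule C.comm_inv_char) (use that in \<open>auto simp: ring_of_type_algebra_def\<close>)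
  have ops: "carrier complex_field = UNIV" "\<one>\<^bsub>complex_field\<^esub> = 1" "\<zero>\<^bsub>complex_field\<^esub> = 0"
    "x \<oplus>\<^bsub>complex_field\<^esub> y = x + y" "x \<otimes>\<^bsub>complex_field\<^esub> y = x * y" for x y
    by (simp_all add: ring_of_type_algebra_def)
  show ?thesis
  proof
    assume L: "subfield L complex_field"
    note sr = subfieldE(1)[OF L]
    have "inverse x \<in> L" if "x \<in> L" for x
      using C.subfield_m_inv(1)[OF L, of x] subringE(2)[OF sr] that inverse
      by (cases "x = 0") (auto simp: ops)
    then show "1 \<in> L \<and> (\<forall>x\<in>L. \<forall>y\<in>L. x + y \<in> L) \<and>
     (\<forall>x\<in>L. \<forall>y\<in>L. x * y \<in> L) \<and> (\<forall>x\<in>L. - x \<in> L) \<and> (\<forall>x\<in>L. inverse x \<in> L)"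
      using subringE(3,5,6,7)[OF sr] by (auto simp: ops uminus)
  next
    assume L: "1 \<in> L \<and> (\<forall>x\<in>L. \<forall>y\<in>L. x + y \<in> L) \<and>
     (\<forall>x\<in>L. \<forall>y\<in>L. x * y \<in> L) \<and> (\<forall>x\<in>L. - x \<in> L) \<and> (\<forall>x\<in>L. inverse x \<in> L)"
    show "subfield L complex_field"
    proof (rule C.subfieldI')
      show "subring L complex_field"
        by (rule C.subringI) (use L in \<open>auto simp: ops uminus\<close>)
      show "\<And>k. k \<in> L - {\<zero>\<^bsub>complex_field\<^esub>} \<Longrightarrow> inv\<^bsub>complex_field\<^esub> k \<in> L"
        using L by (auto simp: ops inverse)
    qed
  qed
qed

lemma subfield_complex_closed:
  assumes "subfield L complex_field"
  shows "1 \<in> L" "0 \<in> L"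
    "x \<in> L \<Longrightarrow> y \<in> L \<Longrightarrow> x + y \<in> L" "x \<in> L \<Longrightarrow> y \<in> L \<Longrightarrow> x - y \<in> L"
    "x \<in> L \<Longrightarrow> y \<in> L \<Longrightarrow> x * y \<in> L" "x \<in> L \<Longrightarrow> - x \<in> L" "x \<in> L \<Longrightarrow> inverse x \<in> L"
    "x \<in> L \<Longrightarrow> y \<in> L \<Longrightarrow> x / y \<in> L"
proof -
  note L = assms[unfolded subfield_complex_iff]
  show "1 \<in> L" "x \<in> L \<Longrightarrow> y \<in> L \<Longrightarrow> x + y \<in> L"
    "x \<in> L \<Longrightarrow> y \<in> L \<Longrightarrow> x * y \<in> L" "x \<in> L \<Longrightarrow> - x \<in> L" "x \<in> L \<Longrightarrow> inverse x \<in> L"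
    using L by auto
  have "1 + - 1 \<in> L" using L by blast
  then show "0 \<in> L" by simp
  show "x \<in> L \<Longrightarrow> y \<in> L \<Longrightarrow> x - y \<in> L" using L by (metis add_uminus_conv_diff)
  show "x \<in> L \<Longrightarrow> y \<in> L \<Longrightarrow> x / y \<in> L" using L by (simp add: divide_inverse)
qed

lemma Rats_subset_subfield:
  assumes "subfield L complex_field"
  shows "\<rat> \<subseteq> L"
proof
  fix q :: complex assume "q \<in> \<rat>"
  then obtain a b where q: "q = of_int a / of_int b" by (elim Rats_cases') auto
  have n: "of_nat n \<in> L" for n
    by (induction n) (use subfield_complex_closed[OF assms] in auto)
  have "of_int i \<in> L" for i
    by (cases i rule: int_cases2) (use n subfield_complex_closed[OF assms] in auto)
  then show "q \<in> L"
    unfolding q by (intro subfield_complex_closed(8)[OF assms])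
qed

lemma subfield_generate_field: "subfield (generate_field complex_field H) complex_field"
proof -
  interpret C: field complex_field by (rule field_from_type_algebra)
  show ?thesis by (rule C.generate_field_is_subfield) (simp add: ring_of_type_algebra_def)
qed

lemma generate_field_subset:
  assumes "subfield L complex_field" "H \<subseteq> L"
  shows "generate_field complex_field H \<subseteq> L"
proof -
  interpret C: field complex_field by (rule field_from_type_algebra)
  show ?thesis
    by (rule C.generate_field_min_subfield1) (use assms in \<open>simp_all add: ring_of_type_algebra_def\<close>)
qed

lemma carrier_galois_group_iff:
  assumes "subfield K complex_field"
  shows "g \<in> carrier (galois_group K) \<longleftrightarrow> g \<in> Bij K \<and> (\<forall>x\<in>K. \<forall>y\<in>K. g (x + y) = g x + g y) \<and>
     (\<forall>x\<in>K. \<forall>y\<in>K. g (x * y) = g x * g y) \<and> (\<forall>q\<in>\<rat>. g q = q)"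
  using subfield_complex_closed[OF assms]
  by (auto simp: galois_group_def ring_iso_def ring_hom_def ring_of_type_algebra_def Bij_def bij_betw_def)

text \<open>The elements fixed by g form a subfield that contains the generators, hence
  everything.\<close>

lemma galois_group_eq_id:
  assumes g: "g \<in> carrier (galois_group (generate_field complex_field H))" and H: "\<And>h. h \<in> H \<Longrightarrow> g h = h"
    and z: "z \<in> generate_field complex_field H"
  shows "g z = z"
proof -
  define K where "K = generate_field complex_field H"
  have K: "subfield K complex_field" unfolding K_def by (rule subfield_generate_field)
  note closed = subfield_complex_closed[OF K]
  note g' = g[folded K_def, unfolded carrier_galois_group_iff[OF K]]
  have g01: "g 1 = 1" "g 0 = 0" using g' by auto
  have "subfield {z \<in> K. g z = z} complex_field"
    unfolding subfield_complex_iff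
  proof (intro conjI ballI)
    fix x assume x: "x \<in> {z \<in> K. g z = z}"
    have "g (x + - x) = x + g (- x)" using x g' closed(6)[of x] by (metis (mono_tags, lifting) mem_Collect_eq)
    then have "g (- x) = - x" using g01 by (simp add: eq_neg_iff_add_eq_0 add.commute)
    then show "- x \<in> {z \<in> K. g z = z}" using x closed by auto
    have "g (inverse x) = inverse x"
    proof (cases "x = 0")
      case False
      have "g (x * inverse x) = x * g (inverse x)" using x g' closed(7)[of x] by (metis (mono_tags, lifting) mem_Collect_eq)
      then show ?thesis using False g01 by (simp add: field_simps)
    qed (use g01 in auto)
    then show "inverse x \<in> {z \<in> K. g z = z}" using x closed by auto
  qed (use g' g01 closed in auto)
  moreover have "H \<subseteq> {z \<in> K. g z = z}"
    using H by (auto simp: K_def intro: generate_field.incl)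
  ultimately have "K \<subseteq> {z \<in> K. g z = z}" unfolding K_def by (rule generate_field_subset)
  with z show ?thesis by (auto simp: K_def)
qed

text \<open>Since \<delta> is not in L, the coordinates u, v of u + v \<delta> are unique, so
  negating v is well defined. It respects products because only \<delta>^2, an element of L, enters
  them.\<close>

lemma quadratic_extension_conjugation:
  assumes L: "subfield L complex_field" and \<delta>: "\<delta> \<notin> L" "\<delta>\<^sup>2 \<in> L"
  defines "M \<equiv> {z. \<exists>u\<in>L. \<exists>v\<in>L. z = u + v * \<delta>}"
  shows "subfield M complex_field"
    "\<exists>\<tau> \<in> carrier (galois_group M). \<tau> \<delta> = - \<delta>"
proof -
  note closed = subfield_complex_closed[OF L]
  have uniq: "u = u' \<and> v = v'" if "u \<in> L" "v \<in> L" "u' \<in> L" "v' \<in> L" "u + v * \<delta> = u' + v' * \<delta>" for u v u' v'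
  proof -
    have "v = v'"
    proof (rule ccontr)
      assume "v \<noteq> v'"
      then have "\<delta> = (u' - u) / (v - v')" using that(5) by (simp add: field_simps)
      moreover have "(u' - u) / (v - v') \<in> L" using that by (intro closed)
      ultimately show False using \<delta>(1) by simp
    qed
    with that(5) show ?thesis by simp
  qed
  have MI: "u + v * \<delta> \<in> M" if "u \<in> L" "v \<in> L" for u v using that by (auto simp: M_def)
  have add: "(u + v * \<delta>) + (u' + v' * \<delta>) = (u + u') + (v + v') * \<delta>" for u v u' v'
    by (simp add: algebra_simps)
  have mult: "(u + v * \<delta>) * (u' + v' * \<delta>) = (u * u' + v * v' * \<delta>\<^sup>2) + (u * v' + v * u') * \<delta>" for u v u' v'
    by (simp add: algebra_simps power2_eq_square)
  have inv: "inverse z \<in> M" if zM: "z \<in> M" for z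
  proof (cases "z = 0")
    case True
    then show ?thesis using MI[of 0 0] closed by simp
  next
    case False
    obtain u v where z: "u \<in> L" "v \<in> L" "z = u + v * \<delta>" using zM by (auto simp: M_def)
    have "u - v * \<delta> \<noteq> 0"
      using uniq[of u "- v" 0 0] False z closed by auto
    then have "(u + v * \<delta>) * (u - v * \<delta>) \<noteq> 0" using False z(3) by simp
    moreover have prod: "(u + v * \<delta>) * (u - v * \<delta>) = u\<^sup>2 - v\<^sup>2 * \<delta>\<^sup>2"
      by (simp add: power2_eq_square algebra_simps)
    ultimately have n: "u\<^sup>2 - v\<^sup>2 * \<delta>\<^sup>2 \<noteq> 0" by simp
    \<comment> \<open>The usual inverse: conjugate divided by norm.\<close>
    have "z * (u / (u\<^sup>2 - v\<^sup>2 * \<delta>\<^sup>2) + (- v / (u\<^sup>2 - v\<^sup>2 * \<delta>\<^sup>2)) * \<delta>) =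
        (u + v * \<delta>) * (u - v * \<delta>) / (u\<^sup>2 - v\<^sup>2 * \<delta>\<^sup>2)"
      unfolding z(3) by (simp add: add_divide_distrib diff_divide_distrib algebra_simps)
    also note prod
    finally have "inverse z = u / (u\<^sup>2 - v\<^sup>2 * \<delta>\<^sup>2) + (- v / (u\<^sup>2 - v\<^sup>2 * \<delta>\<^sup>2)) * \<delta>"
      using n by (metis divide_self inverse_unique)
    moreover have "u\<^sup>2 - v\<^sup>2 * \<delta>\<^sup>2 \<in> L"
      unfolding power2_eq_square[of u] power2_eq_square[of v] by (intro closed z(1,2) \<delta>(2))
    ultimately show ?thesis
      using z(1,2) by (simp only:) (intro MI closed(6,8))
  qed
  show M: "subfield M complex_field"
    unfolding subfield_complex_iff
  proof (intro conjI ballI)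
    show "1 \<in> M" using MI[of 1 0] closed by simp
  next
    fix x y assume "x \<in> M" "y \<in> M"
    then obtain u v u' v' where "u \<in> L" "v \<in> L" "x = u + v * \<delta>" "u' \<in> L" "v' \<in> L" "y = u' + v' * \<delta>"
      by (auto simp: M_def)
    then show "x + y \<in> M" "x * y \<in> M"
      using \<delta>(2) by (simp_all only: add mult) (intro MI closed; assumption)+
  next
    fix x assume "x \<in> M"
    then obtain u v where "u \<in> L" "v \<in> L" "x = u + v * \<delta>"
      by (auto simp: M_def)
    then show "- x \<in> M"
      using closed MI[of "- u" "- v"] by simp
  qed (use inv in auto)
  \<comment> \<open>\<open>uniq\<close> leaves only one choice for \<open>SOME\<close>; restricting
    to M gives the extensionality that \<open>Bij\<close> demands.\<close>
  define \<tau> where "\<tau> = (\<lambda>z\<in>M. SOME w. \<exists>u\<in>L. \<exists>v\<in>L. z = u + v * \<delta> \<and> w = u - v * \<delta>)"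
  have \<tau>: "\<tau> (u + v * \<delta>) = u - v * \<delta>" if "u \<in> L" "v \<in> L" for u v
  proof -
    have "(SOME w. \<exists>u'\<in>L. \<exists>v'\<in>L. u + v * \<delta> = u' + v' * \<delta> \<and> w = u' - v' * \<delta>) = u - v * \<delta>"
    proof (rule some_equality)
      fix w assume "\<exists>u'\<in>L. \<exists>v'\<in>L. u + v * \<delta> = u' + v' * \<delta> \<and> w = u' - v' * \<delta>"
      then show "w = u - v * \<delta>" using uniq that by metis
    qed (use that in blast)
    then show ?thesis using MI[OF that] by (simp add: \<tau>_def)
  qed
  have "\<tau> \<in> carrier (galois_group M)"
    unfolding carrier_galois_group_iff[OF M]
  proof (intro conjI ballI)
    have maps: "\<tau> z \<in> M \<and> \<tau> (\<tau> z) = z" if zM: "z \<in> M" for z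
    proof -
      obtain u v where z: "u \<in> L" "v \<in> L" "z = u + v * \<delta>" using zM by (auto simp: M_def)
      then show ?thesis
        using \<tau>[of u v] \<tau>[of u "- v"] MI[of u "- v"] closed by simp
    qed
    have "bij_betw \<tau> M M"
      by (rule bij_betw_byWitness[of _ \<tau>]) (use maps in auto)
    moreover have "\<tau> \<in> extensional M" by (simp add: \<tau>_def)
    ultimately show "\<tau> \<in> Bij M" by (simp add: Bij_def)
  next
    fix x y assume "x \<in> M" "y \<in> M"
    then obtain u v u' v' where xy: "u \<in> L" "v \<in> L" "x = u + v * \<delta>" "u' \<in> L" "v' \<in> L" "y = u' + v' * \<delta>"
      by (auto simp: M_def)
    have \<tau>xy: "\<tau> x = u - v * \<delta>" "\<tau> y = u' - v' * \<delta>" using xy \<tau> by simp_all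
    have "\<tau> (x + y) = (u + u') - (v + v') * \<delta>"
      unfolding xy add by (rule \<tau>) (use xy closed in auto)
    then show "\<tau> (x + y) = \<tau> x + \<tau> y" unfolding \<tau>xy by (simp add: algebra_simps)
    have "\<tau> (x * y) = (u * u' + v * v' * \<delta>\<^sup>2) - (u * v' + v * u') * \<delta>"
      unfolding xy mult by (rule \<tau>) (use xy closed \<delta> in auto)
    then show "\<tau> (x * y) = \<tau> x * \<tau> y" unfolding \<tau>xy by (simp add: algebra_simps power2_eq_square)
  next
    fix q :: complex assume "q \<in> \<rat>"
    then show "\<tau> q = q" using \<tau>[of q 0] Rats_subset_subfield[OF L] closed by auto
  qed
  moreover have "\<tau> \<delta> = - \<delta>" using \<tau>[of 0 1] closed by simp
  ultimately show "\<exists>\<tau> \<in> carrier (galois_group M). \<tau> \<delta> = - \<delta>" by blast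
qed

section \<open>Rational polynomials at complex points and simple extensions\<close>

lemma poly_of_rat_pCons:
  "poly (map_poly of_rat (pCons a p)) (z::complex) = of_rat a + z * poly (map_poly of_rat p) z"
  by (simp add: map_poly_pCons)

lemma poly_of_rat_add:
  "poly (map_poly of_rat (p + q)) (z::complex) = poly (map_poly of_rat p) z + poly (map_poly of_rat q) z"
  by (induction p q rule: poly_induct2)
     (simp_all add: poly_of_rat_pCons of_rat_add algebra_simps del: map_poly_pCons)

lemma poly_of_rat_smult:
  "poly (map_poly of_rat (smult c p)) (z::complex) = of_rat c * poly (map_poly of_rat p) z"
  by (induction p) (simp_all add: poly_of_rat_pCons of_rat_mult algebra_simps)

lemma poly_of_rat_mult:
  "poly (map_poly of_rat (p * q)) (z::complex) = poly (map_poly of_rat p) z * poly (map_poly of_rat q) z"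
  by (induction p)
     (simp_all add: mult_pCons_left poly_of_rat_add poly_of_rat_pCons poly_of_rat_smult algebra_simps)

lemma poly_of_rat_in_subfield:
  assumes K: "subfield K complex_field" and "z \<in> K"
  shows "poly (map_poly of_rat p) z \<in> K"
proof (induction p)
  case (pCons a p)
  have "of_rat a \<in> K" using Rats_subset_subfield[OF K] by auto
  then show ?case
    unfolding poly_of_rat_pCons
    by (intro subfield_complex_closed(3,5)[OF K] pCons.IH assms(2))
qed (use subfield_complex_closed[OF K] in simp)

lemma cubic_irreducible:
  fixes p :: "'a::field poly"
  assumes "degree p = 3" and no_root: "\<And>x. poly p x \<noteq> 0"
  shows "Factorial_Ring.irreducible p"
proof (rule Factorial_Ring.irreducibleI)
  show "p \<noteq> 0" using assms(1) by auto
  show "\<not> p dvd 1" using assms(1) is_unit_iff_degree[OF \<open>p \<noteq> 0\<close>] by simp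
  have linear: "\<exists>x. poly q x = 0" if q1: "degree q = 1" for q :: "'a poly"
  proof -
    have "coeff q 1 \<noteq> 0" using q1 by (metis degree_0 leading_coeff_0_iff zero_neq_one)
    then have "poly q (- coeff q 0 / coeff q 1) = 0" using q1 by (simp add: poly_altdef)
    then show ?thesis ..
  qed
  fix a b assume p: "p = a * b"
  then have "a \<noteq> 0" "b \<noteq> 0" using \<open>p \<noteq> 0\<close> by auto
  then have "degree a + degree b = 3" using assms(1) p by (simp add: degree_mult_eq)
  moreover have "degree a \<noteq> 1" "degree b \<noteq> 1" using linear no_root p by auto
  ultimately have "degree a = 0 \<or> degree b = 0" by linarith
  then show "a dvd 1 \<or> b dvd 1"
    using is_unit_iff_degree[OF \<open>a \<noteq> 0\<close>] is_unit_iff_degree[OF \<open>b \<noteq> 0\<close>] by simp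
qed

text \<open>For inverses: if f does not divide p, then u f + v p = 1 for some u and v, and
  evaluation at the root z of f turns v into an inverse of p.\<close>

lemma subfield_simple_extension:
  assumes "Factorial_Ring.irreducible f" "poly (map_poly of_rat f) z = 0"
  shows "subfield (range (\<lambda>p. poly (map_poly of_rat p) z)) complex_field"
proof -
  let ?e = "\<lambda>p. poly (map_poly of_rat p) z"
  have "inverse (?e p) \<in> range ?e" for p
  proof (cases "f dvd p")
    case True
    then have "?e p = 0" using assms(2) by (elim dvdE) (simp add: poly_of_rat_mult)
    then have "inverse (?e p) = ?e p" by simp
    then show ?thesis by (metis rangeI)
  next
    case False
    have "prime_elem f" using assms(1) by (rule irreducible_imp_prime_elem_gcd)
    then have "coprime f p" using False by (rule prime_elem_imp_coprime)
    then obtain u v where "u * f + v * p = 1"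
      using bezout_coefficients_fst_snd[of f p] by (metis coprime_iff_gcd_eq_1)
    then have "?e (u * f + v * p) = ?e 1" by simp
    then have "?e v * ?e p = 1"
      using assms(2) by (simp add: poly_of_rat_add poly_of_rat_mult one_pCons poly_of_rat_pCons)
    then have "inverse (?e p) = ?e v" by (metis inverse_unique mult.commute)
    then show ?thesis by (metis rangeI)
  qed
  moreover have "1 \<in> range ?e"
    by (rule range_eqI[of _ _ 1]) (simp add: one_pCons poly_of_rat_pCons)
  moreover have "- ?e p \<in> range ?e" for p
    by (rule range_eqI[of _ _ "smult (- 1) p"]) (simp only: poly_of_rat_smult, simp add: of_rat_minus)
  ultimately show ?thesis
    unfolding subfield_complex_iff
    by (auto simp: poly_of_rat_add[symmetric] poly_of_rat_mult[symmetric])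
qed

section \<open>Roots, discriminant and Galois group of the cubic\<close>

lemma complex_cubic_splits:
  fixes a b c :: complex
  obtains r1 r2 r3 where "[:c, b, a, 1:] = [:- r1, 1:] * [:- r2, 1:] * [:- r3, 1:]"
proof -
  have "[:c, b, a, 1:] \<noteq> 0" by simp
  from alg_closed_imp_factorization[OF this]
  obtain A where A: "size A = 3" "[:c, b, a, 1:] = (\<Prod>x\<in>#A. [:- x, 1:])"
    by (auto simp: eval_nat_numeral)
  obtain r1 B where "A = add_mset r1 B" "size B = 2"
    using A(1) by (metis numeral_3_eq_3 size_Suc_Diff1 size_eq_Suc_imp_eq_union numeral_2_eq_2 old.nat.inject size_add_mset)
  moreover obtain r2 C where "B = add_mset r2 C" "size C = 1"
    using \<open>size B = 2\<close> by (metis numeral_2_eq_2 One_nat_def size_eq_Suc_imp_eq_union old.nat.inject size_add_mset)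
  moreover obtain r3 where "C = {#r3#}"
    using \<open>size C = 1\<close> by (metis size_1_singleton_mset)
  ultimately show ?thesis using A(2) by (intro that[of r1 r2 r3]) (simp only: image_mset_add_mset prod_mset.add_mset image_mset_single prod_mset.singleton image_mset_empty prod_mset.empty mult.right_neutral mult.assoc)
qed

lemma split_cubic:
  fixes a2 a1 a0 :: int and r1 r2 r3 :: complex
  assumes "[:of_int a0, of_int a1, of_int a2, 1:] = [:- r1, 1:] * [:- r2, 1:] * [:- r3, 1:]"
  shows "of_int a2 = - (r1 + r2 + r3)" "of_int a1 = r1*r2 + r2*r3 + r3*r1" "of_int a0 = - (r1*r2*r3)"
    "((r1 - r2) * (r2 - r3) * (r3 - r1))\<^sup>2 =
      of_int (a2^2*a1^2 - 4*a1^3 - 4*a2^3*a0 + 18*a2*a1*a0 - 27*a0^2)"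
proof -
  show vieta: "of_int a2 = - (r1 + r2 + r3)" "of_int a1 = r1*r2 + r2*r3 + r3*r1" "of_int a0 = - (r1*r2*r3)"
    using assms by (auto simp: algebra_simps)
  show "((r1 - r2) * (r2 - r3) * (r3 - r1))\<^sup>2 =
      of_int (a2^2*a1^2 - 4*a1^3 - 4*a2^3*a0 + 18*a2*a1*a0 - 27*a0^2)"
    unfolding of_int_add of_int_diff of_int_mult of_int_power of_int_numeral vieta
    by (simp add: power2_eq_square power3_eq_cube algebra_simps)
qed

text \<open>Of the isomorphism only the order 3!/2 = 3 matters: the cube of every group element is
  then the identity.\<close>

lemma galois_group_order_3_cube:
  assumes K: "subfield K complex_field" and iso: "galois_group K \<cong> alt_group 3"
    and g: "g \<in> carrier (galois_group K)" and z: "z \<in> K"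
  shows "g (g (g z)) = z"
proof -
  interpret G: Group.group "galois_group K" by (rule group_galois_group[OF K])
  have "Coset.order (galois_group K) = 3"
    using iso alt_group_card_carrier[of 3] bij_betw_same_card
    by (fastforce simp: Coset.order_def is_iso_def iso_def fact_numeral)
  then have "g [^]\<^bsub>galois_group K\<^esub> (3::nat) = \<one>\<^bsub>galois_group K\<^esub>"
    using G.pow_order_eq_1[OF g] by simp
  then have "g \<otimes>\<^bsub>galois_group K\<^esub> g \<otimes>\<^bsub>galois_group K\<^esub> g = \<one>\<^bsub>galois_group K\<^esub>"
    using g by (simp add: numeral_3_eq_3)
  moreover have B: "g \<in> Bij K" using g K by (simp add: carrier_galois_group_iff)
  ultimately have eq: "compose K (compose K g g) g = (\<lambda>x\<in>K. x)"
    by (simp add: galois_group_def BijGroup_def compose_Bij)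
  have "g z \<in> K" using B z Bij_imp_funcset by blast
  then show ?thesis using fun_cong[OF eq, of z] z by (simp add: compose_def)
qed

lemma galois_group_order_3_nontrivial:
  assumes K: "subfield K complex_field" and iso: "galois_group K \<cong> alt_group 3"
  obtains g z where "g \<in> carrier (galois_group K)" "z \<in> K" "g z \<noteq> z"
proof -
  have "card (carrier (galois_group K)) = 3"
    using iso alt_group_card_carrier[of 3] bij_betw_same_card
    by (fastforce simp: is_iso_def iso_def fact_numeral)
  then have "\<not> carrier (galois_group K) \<subseteq> {\<lambda>x\<in>K. x}"
    using card_mono[of "{\<lambda>x\<in>K. x}" "carrier (galois_group K)"] by auto
  then obtain g where g: "g \<in> carrier (galois_group K)" "g \<noteq> (\<lambda>x\<in>K. x)" by auto
  have "g \<in> extensional K"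
    using g(1) K by (simp add: carrier_galois_group_iff Bij_def)
  then obtain z where "z \<in> K" "g z \<noteq> z"
    using g(2) extensionalityI[of g K "\<lambda>x\<in>K. x"] by auto
  with g(1) that show ?thesis by blast
qed

lemma cubic_galois_group_A3_discriminant:
  fixes a2 a1 a0 :: int and r1 r2 r3 :: complex
  assumes split: "[:of_int a0, of_int a1, of_int a2, 1:] = [:- r1, 1:] * [:- r2, 1:] * [:- r3, 1:]"
    and iso: "galois_group (generate_field complex_field {r1, r2, r3}) \<cong> alt_group 3"
  shows "(r1 - r2) * (r2 - r3) * (r3 - r1) \<in> \<rat>"
proof (cases "r1 = r2 \<or> r2 = r3 \<or> r3 = r1")
  case False
  then have dist: "r1 \<noteq> r2" "r2 \<noteq> r3" "r3 \<noteq> r1" by auto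
  define K where "K = generate_field complex_field {r1, r2, r3}"
  define \<delta> where "\<delta> = (r1 - r2) * (r2 - r3) * (r3 - r1)"
  have K: "subfield K complex_field" unfolding K_def by (rule subfield_generate_field)
  note closed = subfield_complex_closed[OF K]
  have rK: "r1 \<in> K" "r2 \<in> K" "r3 \<in> K" by (auto simp: K_def intro: generate_field.incl)
  have \<delta>K: "\<delta> \<in> K" unfolding \<delta>_def by (intro closed rK)
  note vieta = split_cubic(1-3)[OF split]
  have roots: "z \<in> {r1, r2, r3} \<longleftrightarrow> z*z*z + of_int a2*z*z + of_int a1*z + of_int a0 = 0" for z
  proof -
    have "z*z*z + of_int a2*z*z + of_int a1*z + of_int a0 = (z - r1) * (z - r2) * (z - r3)"
      unfolding vieta by (simp add: algebra_simps)
    then show ?thesis by simp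
  qed
  have perm: "g r \<in> {r1, r2, r3}" if g: "g \<in> carrier (galois_group K)" and r: "r \<in> {r1, r2, r3}" for g r
  proof -
    note g' = g[unfolded carrier_galois_group_iff[OF K]]
    have rK': "r \<in> K" using r rK by auto
    have QK: "of_int a \<in> K" for a using Rats_subset_subfield[OF K] by auto
    have "g (r*r*r + of_int a2*r*r + of_int a1*r + of_int a0) = g r*g r*g r + of_int a2*g r*g r + of_int a1*g r + of_int a0"
      using g' rK' QK closed(3,5) by simp
    moreover have "g 0 = 0" using g' by auto
    ultimately show ?thesis using r unfolding roots by simp
  qed
  have cyc: "(g r1 = r1 \<and> g r2 = r2 \<and> g r3 = r3) \<or> (g r1 = r2 \<and> g r2 = r3 \<and> g r3 = r1) \<or>
      (g r1 = r3 \<and> g r2 = r1 \<and> g r3 = r2)"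
    if g: "g \<in> carrier (galois_group K)" for g
  proof -
    \<comment> \<open>A map of the three roots into themselves whose cube is the identity is the
      identity or a 3-cycle; transpositions are ruled out.\<close>
    have "g (g (g r1)) = r1" "g (g (g r2)) = r2" "g (g (g r3)) = r3"
      using galois_group_order_3_cube[OF K iso[folded K_def] g] rK by auto
    moreover have "g r1 = r1 \<or> g r1 = r2 \<or> g r1 = r3" "g r2 = r1 \<or> g r2 = r2 \<or> g r2 = r3"
      "g r3 = r1 \<or> g r3 = r2 \<or> g r3 = r3"
      using perm[OF g] by blast+
    ultimately show ?thesis
      using dist by - (elim disjE; simp)
  qed
  have fix_\<delta>: "g \<delta> = \<delta>" if g: "g \<in> carrier (galois_group K)" for g
  proof -
    note g' = g[unfolded carrier_galois_group_iff[OF K]]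
    have diff: "g (x - y) = g x - g y" if "x \<in> K" "y \<in> K" for x y
    proof -
      have "g ((x - y) + y) = g (x - y) + g y" using g' that closed by blast
      then show ?thesis by simp
    qed
    have "g \<delta> = (g r1 - g r2) * (g r2 - g r3) * (g r3 - g r1)"
      unfolding \<delta>_def using g' rK closed diff by simp
    then show ?thesis using cyc[OF g] unfolding \<delta>_def by auto
  qed
  obtain g z where g: "g \<in> carrier (galois_group K)" and z: "z \<in> K" "g z \<noteq> z"
    using galois_group_order_3_nontrivial[OF K iso[folded K_def]] by blast
  have "\<not> (g r1 = r1 \<and> g r2 = r2 \<and> g r3 = r3)"
    using galois_group_eq_id[OF g[unfolded K_def] _ z(1)[unfolded K_def]] z(2) by auto
  with cyc[OF g] have gc: "(g r1 = r2 \<and> g r2 = r3 \<and> g r3 = r1) \<or> (g r1 = r3 \<and> g r2 = r1 \<and> g r3 = r2)"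
    by blast
  then have "g r \<noteq> r" if "r \<in> {r1, r2, r3}" for r using dist that by auto
  \<comment> \<open>Automorphisms fix rational numbers, but g moves every root. So the cubic has no
    rational root and is irreducible.\<close>
  then have irrat: "r \<notin> \<rat>" if "r \<in> {r1, r2, r3}" for r
    using g[unfolded carrier_galois_group_iff[OF K]] that by metis
  define f :: "rat poly" where "f = [:of_int a0, of_int a1, of_int a2, 1:]"
  have f_root: "poly (map_poly of_rat f) r = 0" if "r \<in> {r1, r2, r3}" for r
    using that unfolding roots by (simp add: f_def map_poly_pCons algebra_simps)
  have "poly f q \<noteq> 0" for q
  proof
    assume "poly f q = 0"
    then have "of_rat (poly f q) = (0::complex)" by simp
    then have "of_rat q \<in> {r1, r2, r3}"
      unfolding roots by (simp add: f_def of_rat_add of_rat_mult algebra_simps)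
    then show False using irrat[of "of_rat q"] by simp
  qed
  then have "Factorial_Ring.irreducible f" by (intro cubic_irreducible) (simp_all add: f_def)
  define L where "L = range (\<lambda>p. poly (map_poly of_rat p) r1)"
  have L: "subfield L complex_field"
    unfolding L_def by (rule subfield_simple_extension[OF \<open>irreducible f\<close>]) (use f_root in simp)
  note closedL = subfield_complex_closed[OF L]
  have r1L: "r1 \<in> L"
    unfolding L_def by (rule range_eqI[of _ _ "[:0, 1:]"]) (simp add: map_poly_pCons)
  have QL: "\<rat> \<subseteq> L" using L by (rule Rats_subset_subfield)
  have LK: "L \<subseteq> K" using poly_of_rat_in_subfield[OF K rK(1)] by (auto simp: L_def)
  show ?thesis
  proof (cases "\<delta> \<in> L")
    case True
    then obtain p where p: "\<delta> = poly (map_poly of_rat p) r1" by (auto simp: L_def)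
    \<comment> \<open>Reduction modulo the cubic keeps the value at \<open>r1\<close> and brings the
      degree below 3.\<close>
    define q where "q = p mod f"
    have deg_f: "degree f = 3" "f \<noteq> 0" by (simp_all add: f_def)
    have deg_q: "degree q < 3" unfolding q_def using degree_mod_less'[of f p] deg_f by (cases "p mod f = 0") auto
    have "poly (map_poly of_rat p) r1 = poly (map_poly of_rat (p div f * f + q)) r1"
      by (simp add: q_def)
    then have q1: "poly (map_poly of_rat q) r1 = \<delta>"
      using p f_root[of r1] by (simp only: poly_of_rat_add poly_of_rat_mult) simp
    have g_poly: "poly (map_poly of_rat q) (g r) = g (poly (map_poly of_rat q) r)" if "r \<in> K" for r q
    proof (induction q)
      case 0
      then show ?case using g[unfolded carrier_galois_group_iff[OF K]] by auto
    next
      case (pCons a q)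
      have "poly (map_poly of_rat q) r \<in> K" using K that by (rule poly_of_rat_in_subfield)
      moreover have "of_rat a \<in> K" using Rats_subset_subfield[OF K] by auto
      ultimately show ?case
        using g[unfolded carrier_galois_group_iff[OF K]] pCons that closed
        by (simp add: map_poly_pCons)
    qed
    have q3: "poly (map_poly of_rat q) r = \<delta>" if "r \<in> {r1, r2, r3}" for r
      using gc g_poly[OF rK(1), of q] g_poly[OF rK(2), of q] g_poly[OF rK(3), of q] q1 fix_\<delta>[OF g] that
      by auto
    \<comment> \<open>h has degree at most 2 but vanishes at three distinct roots, so it is zero and
      \<delta> is the constant coefficient of q.\<close>
    define h where "h = map_poly of_rat q - [:\<delta>:]"
    have "h = 0"
    proof (rule ccontr)
      assume "h \<noteq> 0"
      then have "card {z. poly h z = 0} \<le> degree h" by (rule card_poly_roots_bound)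
      also have "degree h \<le> degree q"
        unfolding h_def by (rule order.trans[OF degree_diff_le_max]) (simp add: map_poly_degree_leq)
      also have "\<dots> < card {r1, r2, r3}" using deg_q dist by simp
      also have "\<dots> \<le> card {z. poly h z = 0}"
        by (rule card_mono) (use q3 poly_roots_finite[OF \<open>h \<noteq> 0\<close>] in \<open>auto simp: h_def\<close>)
      finally show False by simp
    qed
    then have "\<delta> = coeff (map_poly of_rat q) 0" by (simp add: h_def)
    then show ?thesis by (simp add: coeff_map_poly \<delta>_def)
  next
    case False
    have "\<delta>\<^sup>2 \<in> L"
      unfolding \<delta>_def split_cubic(4)[OF split] by (intro subsetD[OF QL] Rats_of_int)
    define M where "M = {z. \<exists>u\<in>L. \<exists>v\<in>L. z = u + v * \<delta>}"
    note M = quadratic_extension_conjugation[OF L False \<open>\<delta>\<^sup>2 \<in> L\<close>, folded M_def]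
    have MI: "u + v * \<delta> \<in> M" if "u \<in> L" "v \<in> L" for u v using that by (auto simp: M_def)
    note closedM = subfield_complex_closed[OF M(1)]
    have "L \<subseteq> M" using MI[of _ 0] closedL by auto
    have "\<delta> \<in> M" using MI[of 0 1] closedL by auto
    have a2M: "of_int a2 \<in> M" using Rats_subset_subfield[OF M(1)] by auto
    have r1M: "r1 \<in> M" using r1L \<open>L \<subseteq> M\<close> by blast
    \<comment> \<open>This is minus the derivative of the cubic at \<open>r1\<close>, an element of
      L. Dividing \<delta> by it gives \<open>r2 - r3\<close>, and the sum \<open>r2 + r3\<close> is
      known from \<open>a2\<close> and \<open>r1\<close>; hence M contains all roots.\<close>
    have "(r1 - r2) * (r3 - r1) = - (3 * r1 * r1 + 2 * of_int a2 * r1 + of_int a1)"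
      unfolding vieta by (simp add: algebra_simps)
    also have "\<dots> \<in> L"
    proof -
      have "3 \<in> L" "2 \<in> L" "of_int a2 \<in> L" "of_int a1 \<in> L" using QL by auto
      then show ?thesis by (intro closedL r1L)
    qed
    finally have "(r1 - r2) * (r3 - r1) \<in> M" using \<open>L \<subseteq> M\<close> by blast
    moreover have "r2 - r3 = \<delta> / ((r1 - r2) * (r3 - r1))"
      using dist by (simp add: \<delta>_def)
    ultimately have d: "r2 - r3 \<in> M" using \<open>\<delta> \<in> M\<close> closedM(8) by metis
    have two: "2 \<in> M" using Rats_subset_subfield[OF M(1)] by auto
    have "r2 = ((- of_int a2 - r1) + (r2 - r3)) / 2" "r3 = ((- of_int a2 - r1) - (r2 - r3)) / 2"
      unfolding vieta by simp_all
    then have "r2 \<in> M" "r3 \<in> M"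
      using closedM(3,4,6,8) a2M r1M d two by metis+
    then have "K \<subseteq> M" unfolding K_def by (intro generate_field_subset M(1)) (use r1M in auto)
    moreover have "M \<subseteq> K" unfolding M_def using LK by (auto intro!: closed(3,5) \<delta>K)
    ultimately have "M = K" by blast
    \<comment> \<open>The conjugation negates \<delta>, while every automorphism of K fixes it; so
      \<delta> is 0, which is rational.\<close>
    then obtain \<tau> where "\<tau> \<in> carrier (galois_group K)" "\<tau> \<delta> = - \<delta>" using M(2) by auto
    with fix_\<delta> have "\<delta> = - \<delta>" by metis
    then have "\<delta> = 0" by simp
    then show ?thesis unfolding \<delta>_def[symmetric] by simp
  qed
next
  case True
  then have "(r1 - r2) * (r2 - r3) * (r3 - r1) = 0" by auto
  then show ?thesis by (simp only: Rats_0)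
qed

section \<open>Integrality of the discriminant's square root and conclusion\<close>

lemma rational_square_of_int:
  fixes x :: "'a::field_char_0"
  assumes "x \<in> \<rat>" "x\<^sup>2 = of_int n"
  obtains k where "x = of_int k"
proof -
  obtain a b where ab: "x = of_int a / of_int b" "b > 0" "coprime a b"
    using assms(1) by (rule Rats_cases')
  have "of_int (a\<^sup>2) = (x * of_int b)\<^sup>2" using ab(1,2) by simp
  also have "\<dots> = of_int (n * b\<^sup>2)" using assms(2) by (simp add: power_mult_distrib)
  finally have "of_int (a\<^sup>2) = (of_int (n * b\<^sup>2) :: 'a)" .
  then have "a\<^sup>2 = n * b\<^sup>2" by (simp only: of_int_eq_iff)
  \<comment> \<open>The denominator b divides a^2 and is coprime to it, so it is 1.\<close>
  then have "b dvd a\<^sup>2" by (simp add: power2_eq_square)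
  moreover have "coprime b (a\<^sup>2)" using ab(3) by (simp add: coprime_commute)
  ultimately have "b dvd 1" by (metis coprime_common_divisor dvd_refl)
  with ab(1,2) that show ?thesis by simp
qed

theorem theorem1p2:
  fixes a2 a1 a0 :: int
  assumes "irreducible_over_rat (cubic_form a2 a1 a0)"
    and "Gal (cubic_form a2 a1 a0) \<cong> alt_group 3"
  shows "\<exists>c1 c2 s t :: int. gcd s t = 1 \<and>
    ((\<not> 3 dvd s^2 - s*t + t^2 \<and>
      (let c = c1^2 - c1*c2 + c2^2 in
        inv_I a2 a1 a0 = 9*c*(s^2 - s*t + t^2) \<and>
        inv_J a2 a1 a0 =
          27*c*((2*c1 - c2)*s^3 - 3*(c1 + c2)*s^2*t + 3*(2*c2 - c1)*s*t^2 + (2*c1 - c2)*t^3)))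
    \<or> (\<not> 3 dvd c1 \<and> \<not> 3 dvd s^2 - s*t + t^2 \<and>
      (let c = c1^2 - 3*c1*c2 + 9*c2^2 in
        inv_I a2 a1 a0 = 3*c*(s^2 - s*t + t^2) \<and>
        inv_J a2 a1 a0 = 27*c*(c2*s^3 + (c1 - 3*c2)*s^2*t - c1*s*t^2 + c2*t^3)))
    \<or> (\<not> 3 dvd c1 \<and> \<not> 3 dvd s^2 - s*t + t^2 \<and>
      (let c = c1^2 - 3*c1*c2 + 9*c2^2 in
        inv_I a2 a1 a0 = c*(s^2 - s*t + t^2) \<and>
        inv_J a2 a1 a0 =
          c*((2*c1 - 3*c2)*s^3 - 3*(c1 + 3*c2)*s^2*t + 3*(6*c2 - c1)*s*t^2 + (2*c1 - 3*c2)*t^3))))"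
proof -
  obtain r1 r2 r3 :: complex where split: "[:of_int a0, of_int a1, of_int a2, 1:] = [:- r1, 1:] * [:- r2, 1:] * [:- r3, 1:]"
    by (rule complex_cubic_splits[where a = "of_int a2" and b = "of_int a1" and c = "of_int a0"])
  have "{z. poly [:of_int a0, of_int a1, of_int a2, 1:] z = 0} = {r1, r2, r3}"
    unfolding split poly_mult mult_eq_0_iff by auto
  then have "splitting_field (map_poly rat_of_int (dehomogenise (cubic_form a2 a1 a0))) =
      generate_field complex_field {r1, r2, r3}"
    by (simp add: splitting_field_def dehomogenise_cubic_form map_poly_pCons)
  then have iso: "galois_group (generate_field complex_field {r1, r2, r3}) \<cong> alt_group 3"
    using assms(2) by (simp add: Gal_def)
  define \<delta> where "\<delta> = (r1 - r2) * (r2 - r3) * (r3 - r1)"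
  have \<delta>: "\<delta> \<in> \<rat>"
    unfolding \<delta>_def by (rule cubic_galois_group_A3_discriminant[OF split iso])
  have "\<delta>\<^sup>2 = of_int (a2^2*a1^2 - 4*a1^3 - 4*a2^3*a0 + 18*a2*a1*a0 - 27*a0^2)"
    unfolding \<delta>_def by (rule split_cubic(4)[OF split])
  moreover obtain k where k: "\<delta> = of_int k"
    using \<delta> calculation by (rule rational_square_of_int)
  ultimately have "(of_int (k\<^sup>2) :: complex) = of_int (a2^2*a1^2 - 4*a1^3 - 4*a2^3*a0 + 18*a2*a1*a0 - 27*a0^2)"
    by simp
  then have "k\<^sup>2 = a2^2*a1^2 - 4*a1^3 - 4*a2^3*a0 + 18*a2*a1*a0 - 27*a0^2"
    by (simp only: of_int_eq_iff)
  then have "4 * (inv_I a2 a1 a0)^3 = (inv_J a2 a1 a0)^2 + 27 * k^2"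
    unfolding inv_I_def inv_J_def by (simp add: power2_eq_square power3_eq_cube algebra_simps)
  moreover have "27 dvd inv_J a2 a1 a0" if "3 dvd inv_I a2 a1 a0"
  proof -
    \<comment> \<open>I + 3 \<open>a1\<close> is the square of \<open>a2\<close>, so 3 divides
      \<open>a2\<close>, and then each term of J is a multiple of 27.\<close>
    have "3 dvd inv_I a2 a1 a0 + 3 * a1" using that by (intro dvd_add) auto
    then have "3 dvd a2^2" by (simp add: inv_I_def)
    then have "3 dvd a2" using prime_dvd_power_int[of 3] by simp
    then obtain b where "a2 = 3 * b" by (elim dvdE)
    then have "inv_J a2 a1 a0 = 27 * (- 2 * b^3 + b * a1 - a0)"
      by (simp add: inv_J_def power3_eq_cube)
    then show ?thesis by (rule dvdI)
  qed
  ultimately show ?thesis by (intro syzygy_solutions impI)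
qed

end
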